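(* Let $C$ be the pseudo-arc, let $\mathcal{U}=\{U_1,\dots,U_7\}$ be a taut chain cover of $C$ and assume that the continuous map $f:C\to C$ stretches $\mathcal{U}$. Then for every integer $k\ge2$ there exists a closed set $D\subset\overline{U_4}$ with $f(D)\subset D$ such that $(D,f|_D)$ is an extension of the full one-sided shift $(\Sigma_k^+,\sigma)$ on $k$ symbols, i.e. there is a continuous surjection $\pi:D\to\Sigma_k^+$ with $\pi\circ f=\sigma\circ\pi$.
   Context: A chain cover of a continuum $X$ is a finite sequence $U_1,\dots,U_n$ of open sets covering $X$ with $U_i\cap U_j\ne\emptyset$ iff $|i-j|\le1$; it is taut if moreover $\overline{U_i}\cap\overline{U_j}\ne\emptyset$ iff $|i-j|\le1$. A map $f$ stretches a taut chain cover $\{U_1,\dots,U_7\}$ if $f(U_3)\subset U_1$ and $f(U_5)\subset U_7$, or $f(U_5)\subset U_1$ and $f(U_3)\subset U_7$. $\Sigma_k^+=\{1,\dots,k\}^{\mathbb{N}}$ with the product topology and $\sigma$ the left shift. *)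

theory Defs
  imports "HOL-Analysis.Analysis"
begin

definition continuum :: "'a::metric_space set \<Rightarrow> bool" where
  "continuum K \<longleftrightarrow> K \<noteq> {} \<and> compact K \<and> connected K"

definition decomposable :: "'a::metric_space set \<Rightarrow> bool" where
  "decomposable K \<longleftrightarrow> (\<exists>A B. continuum A \<and> continuum B \<and> A \<subset> K \<and> B \<subset> K \<and> K = A \<union> B)"

definition hereditarily_indecomposable :: "'a::metric_space set \<Rightarrow> bool" where
  "hereditarily_indecomposable C \<longleftrightarrow> (\<forall>K. K \<subseteq> C \<and> continuum K \<longrightarrow> \<not> decomposable K)"

definition chain_cover :: "'a::metric_space set \<Rightarrow> nat \<Rightarrow> (nat \<Rightarrow> 'a set) \<Rightarrow> bool" where
  "chain_cover X n U \<longleftrightarrow> n \<ge> 1 \<and>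
     (\<forall>i\<in>{1..n}. openin (top_of_set X) (U i)) \<and>
     (\<Union>i\<in>{1..n}. U i) = X \<and>
     (\<forall>i\<in>{1..n}. \<forall>j\<in>{1..n}. (U i \<inter> U j \<noteq> {}) \<longleftrightarrow> (i \<le> j + 1 \<and> j \<le> i + 1))"

definition taut_chain_cover :: "'a::metric_space set \<Rightarrow> nat \<Rightarrow> (nat \<Rightarrow> 'a set) \<Rightarrow> bool" where
  "taut_chain_cover X n U \<longleftrightarrow> chain_cover X n U \<and>
     (\<forall>i\<in>{1..n}. \<forall>j\<in>{1..n}. (closure (U i) \<inter> closure (U j) \<noteq> {}) \<longleftrightarrow> (i \<le> j + 1 \<and> j \<le> i + 1))"

definition chainable :: "'a::metric_space set \<Rightarrow> bool" where
  "chainable X \<longleftrightarrow> (\<forall>e>0. \<exists>n U. chain_cover X n U \<and> (\<forall>i\<in>{1..n}. diameter (U i) < e))"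

text \<open>The pseudo-arc, via Bing's characterization: a nondegenerate hereditarily
  indecomposable chainable (metric) continuum.\<close>
definition pseudo_arc :: "'a::metric_space set \<Rightarrow> bool" where
  "pseudo_arc C \<longleftrightarrow> continuum C \<and> (\<nexists>x. C = {x}) \<and> hereditarily_indecomposable C \<and> chainable C"

definition stretches :: "('a \<Rightarrow> 'a) \<Rightarrow> (nat \<Rightarrow> 'a set) \<Rightarrow> bool" where
  "stretches f U \<longleftrightarrow> (f ` U 3 \<subseteq> U 1 \<and> f ` U 5 \<subseteq> U 7) \<or> (f ` U 5 \<subseteq> U 1 \<and> f ` U 3 \<subseteq> U 7)"

definition shift_space :: "nat \<Rightarrow> (nat \<Rightarrow> nat) topology" where
  "shift_space k = product_topology (\<lambda>_. discrete_topology {1..k}) UNIV"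

definition shift :: "(nat \<Rightarrow> nat) \<Rightarrow> (nat \<Rightarrow> nat)" where
  "shift x = (\<lambda>n. x (Suc n))"

end

theory Submission
  imports Defs
begin

text \<open>Let \<open>M\<close> be the part of \<open>U 4\<close> outside the
  other links, and call a continuum in \<open>M\<close> from \<open>closure (U 3)\<close> to \<open>closure (U 5)\<close> a crossing. The
  image of a crossing under a stretching map joins \<open>closure (U 1)\<close> to \<open>closure (U 7)\<close>. By
  hereditary indecomposability there are, for each \<open>k\<close>, pairwise disjoint closed sets \<open>Z 1, \<dots>, Z k\<close> such that every
  continuum joining \<open>closure (U 1)\<close> to \<open>closure (U 7)\<close> contains a crossing inside each \<open>Z i\<close>. So the
  image of any crossing contains a crossing in each of the \<open>k\<close> disjoint sets \<open>M \<inter> Z i\<close>: a horseshoe,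
  in which every itinerary is realised by compactness.\<close>

section \<open>Separating closed sets in compacta, and crossings of continua\<close>

text \<open>The general theorem demands that no connected set meet both \<open>F\<close> and
  \<open>G\<close>. Testing continua suffices, because the closure of a nonempty connected subset of
  the compact set \<open>K\<close> is a continuum in \<open>K\<close>.\<close>

lemma cut_wire_fence_compact:
  fixes K :: "'a::metric_space set"
  assumes "compact K" "closed F" "closed G"
    and none: "\<forall>S. continuum S \<and> S \<subseteq> K \<longrightarrow> S \<inter> F = {} \<or> S \<inter> G = {}"
  obtains P Q where "compact P" "compact Q" "P \<union> Q = K" "P \<inter> Q = {}"
    "K \<inter> F \<subseteq> P" "K \<inter> G \<subseteq> Q"
proof -
  have "separated_between (top_of_set K) (K \<inter> F) (K \<inter> G)"
  proof (rule cut_wire_fence_theorem)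
    show "compact_space (top_of_set K)"
      using assms(1) by (simp add: compact_space_subtopology)
    show "Hausdorff_space (top_of_set K)"
      by (simp add: Hausdorff_space_subtopology)
    show "closedin (top_of_set K) (K \<inter> F)" "closedin (top_of_set K) (K \<inter> G)"
      using assms by (auto simp: closedin_closed)
    show "disjnt S (K \<inter> F) \<or> disjnt S (K \<inter> G)" if "connectedin (top_of_set K) S" for S
    proof (cases "S = {}")
      case False
      have S: "connected S" "S \<subseteq> K"
        using that by (auto simp: connectedin_subtopology)
      then have "closure S \<subseteq> K"
        using assms(1) by (simp add: closure_minimal compact_imp_closed)
      moreover have "continuum (closure S)"
        unfolding continuum_def
        using False S calculation assms(1)
        by (metis closed_closure closure_eq_empty compact_Int_closed connected_imp_connected_closure inf.absorb2)
      ultimately show ?thesis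
        using none closure_subset unfolding disjnt_def by blast
    qed auto
  qed
  then obtain P Q where "closedin (top_of_set K) P" "closedin (top_of_set K) Q" "P \<union> Q = K"
      "disjnt P Q" "K \<inter> F \<subseteq> P" "K \<inter> G \<subseteq> Q"
    unfolding separated_between_alt by auto
  then show ?thesis
    using that assms(1) by (metis closedin_compact_eq disjnt_def)
qed

text \<open>Without such an \<open>S\<close>, the set \<open>J \<inter> E\<close> splits into
  disjoint compact pieces, one containing its part in \<open>L\<close> and the other its part in
  \<open>R\<close>. Adding \<open>J \<inter> L\<close> to the first and \<open>J \<inter> R\<close>
  to the second would disconnect \<open>J\<close>.\<close>

lemma continuum_crossing:
  fixes J :: "'a::metric_space set"
  assumes J: "continuum J" and "closed L" "closed E" "closed R"
    and cov: "J \<subseteq> L \<union> E \<union> R" and dis: "J \<inter> L \<inter> R = {}"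
    and L: "J \<inter> L \<noteq> {}" and R: "J \<inter> R \<noteq> {}"
  obtains S where "continuum S" "S \<subseteq> J \<inter> E" "S \<inter> L \<noteq> {}" "S \<inter> R \<noteq> {}"
proof (rule ccontr)
  assume "\<not> thesis"
  then have none: "\<forall>S. continuum S \<and> S \<subseteq> J \<inter> E \<longrightarrow> S \<inter> L = {} \<or> S \<inter> R = {}"
    using that by blast
  have cJ: "compact J" "connected J"
    using J by (auto simp: continuum_def)
  then have "compact (J \<inter> E)"
    using assms by (simp add: compact_Int_closed)
  then obtain P Q where PQ: "compact P" "compact Q" "P \<union> Q = J \<inter> E" "P \<inter> Q = {}"
    "J \<inter> E \<inter> L \<subseteq> P" "J \<inter> E \<inter> R \<subseteq> Q"
    using cut_wire_fence_compact[OF _ \<open>closed L\<close> \<open>closed R\<close> none] by metis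
  let ?A = "P \<union> (J \<inter> L)" and ?B = "Q \<union> (J \<inter> R)"
  have "closed ?A" "closed ?B"
    using PQ cJ assms by (auto intro!: closed_Un compact_imp_closed closed_Int)
  moreover have "J \<subseteq> ?A \<union> ?B" "?A \<inter> ?B \<inter> J = {}" "?A \<inter> J \<noteq> {}" "?B \<inter> J \<noteq> {}"
    using PQ cov dis L R by blast+
  ultimately show False
    using cJ(2) unfolding connected_closed by blast
qed

section \<open>Disjoint crossings from hereditary indecomposability\<close>

text \<open>If neither contained the other, both would be proper subcontinua of their union, which
  would be a decomposable continuum inside \<open>C\<close>.\<close>

lemma hereditarily_indecomposable_nested:
  assumes "hereditarily_indecomposable C" "continuum S" "continuum T" "S \<subseteq> C" "T \<subseteq> C"
    and "S \<inter> T \<noteq> {}"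
  shows "S \<subseteq> T \<or> T \<subseteq> S"
proof (rule ccontr)
  assume "\<not> ?thesis"
  then have "S \<subset> S \<union> T" "T \<subset> S \<union> T"
    by auto
  then have "decomposable (S \<union> T)"
    using assms unfolding decomposable_def by blast
  moreover have "continuum (S \<union> T)"
    using assms by (auto simp: continuum_def intro: compact_Un connected_Un)
  ultimately show False
    using assms unfolding hereditarily_indecomposable_def by (metis Un_least)
qed

text \<open>This is the part of the Krasinkiewicz--Minc crookedness criterion that is needed:
  a continuum leaving \<open>A\<close> that avoids \<open>V\<close> and a continuum leaving \<open>B\<close> that avoids \<open>U\<close> cannot
  meet, since neither contains the other. Hence the unions of such continua can be enclosed in
  disjoint closed sets \<open>P\<close> and \<open>Q\<close>, which are relatively clopen off \<open>V\<close> and off \<open>U\<close>.\<close>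
lemma two_disjoint_crossings:
  fixes C :: "'a::metric_space set"
  assumes hi: "hereditarily_indecomposable C" and C: "compact C"
    and cl: "closed A" "closed B" and op: "open U" "open V"
    and sub: "A \<subseteq> U" "B \<subseteq> V" and UV: "U \<inter> V = {}"
  obtains P Q where "closed P" "closed Q" "P \<inter> Q = {}"
    "\<And>J. \<lbrakk>continuum J; J \<subseteq> C; J \<inter> A \<noteq> {}; J \<inter> B \<noteq> {}\<rbrakk> \<Longrightarrow>
       (\<exists>S. continuum S \<and> S \<subseteq> J \<inter> P \<and> S \<inter> closure U \<noteq> {} \<and> S \<inter> closure V \<noteq> {}) \<and>
       (\<exists>S. continuum S \<and> S \<subseteq> J \<inter> Q \<and> S \<inter> closure U \<noteq> {} \<and> S \<inter> closure V \<noteq> {})"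
proof -
  have cU: "compact (C - U)" and cV: "compact (C - V)"
    using C op by (auto intro: compact_diff)
  define Q0 where "Q0 = \<Union>{T. continuum T \<and> T \<subseteq> C - U \<and> T \<inter> B \<noteq> {}}"
  \<comment> \<open>\<open>Q0\<close> must be closed to be separated from \<open>A\<close> below. A
    point of \<open>C - U\<close> outside \<open>Q0\<close> is separated from \<open>B\<close> by a
    partition of \<open>C - U\<close> into compact sets. Every continuum making up \<open>Q0\<close>
    meets \<open>B\<close>, hence lies on the side of \<open>B\<close>, and so does the closure of
    \<open>Q0\<close>.\<close>
  have "closure Q0 \<subseteq> Q0"
  proof
    fix x assume x: "x \<in> closure Q0"
    have "Q0 \<subseteq> C - U"
      unfolding Q0_def by auto
    then have xCU: "x \<in> C - U"
      using x cU by (meson closure_minimal compact_imp_closed subsetD)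
    show "x \<in> Q0"
    proof (rule ccontr)
      assume nx: "x \<notin> Q0"
      have none: "\<forall>S. continuum S \<and> S \<subseteq> C - U \<longrightarrow> S \<inter> {x} = {} \<or> S \<inter> B = {}"
        using nx unfolding Q0_def by blast
      obtain P Q where PQ: "compact P" "compact Q" "P \<union> Q = C - U" "P \<inter> Q = {}"
        "(C - U) \<inter> {x} \<subseteq> P" "(C - U) \<inter> B \<subseteq> Q"
        using cut_wire_fence_compact[OF cU _ cl(2) none] by (metis closed_singleton)
      have "Q0 \<subseteq> Q"
      proof
        fix y assume "y \<in> Q0"
        then obtain T where T: "continuum T" "T \<subseteq> C - U" "T \<inter> B \<noteq> {}" "y \<in> T"
          unfolding Q0_def by blast
        have "P \<inter> T = {} \<or> Q \<inter> T = {}"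
          using T(1) PQ T(2) unfolding continuum_def connected_closed
          by (metis Int_assoc Int_commute Int_empty_right compact_imp_closed)
        then show "y \<in> Q"
          using T PQ by blast
      qed
      then have "x \<in> Q"
        using x PQ(2) by (meson closure_minimal compact_imp_closed subsetD)
      then show False
        using xCU PQ by blast
    qed
  qed
  then have clQ0: "closed Q0"
    by (metis closure_subset closure_eq subset_antisym)
  \<comment> \<open>\<open>S \<subseteq> T\<close> would put a point of
    \<open>A \<subseteq> U\<close> into \<open>T\<close>, and \<open>T \<subseteq> S\<close> a point
    of \<open>B \<subseteq> V\<close> into \<open>S\<close>.\<close>
  have none1: "\<forall>S. continuum S \<and> S \<subseteq> C - V \<longrightarrow> S \<inter> A = {} \<or> S \<inter> Q0 = {}"
  proof (intro allI impI, rule ccontr)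
    fix S assume S: "continuum S \<and> S \<subseteq> C - V" and H: "\<not> (S \<inter> A = {} \<or> S \<inter> Q0 = {})"
    then obtain T where T: "continuum T" "T \<subseteq> C - U" "T \<inter> B \<noteq> {}" "S \<inter> T \<noteq> {}"
      unfolding Q0_def by blast
    then have "S \<subseteq> T \<or> T \<subseteq> S"
      using hereditarily_indecomposable_nested[OF hi] S by blast
    then show False
      using H T S sub by blast
  qed
  obtain P P' where P: "compact P" "compact P'" "P \<union> P' = C - V" "P \<inter> P' = {}"
    "(C - V) \<inter> A \<subseteq> P" "(C - V) \<inter> Q0 \<subseteq> P'"
    using cut_wire_fence_compact[OF cV cl(1) clQ0 none1] by metis
  \<comment> \<open>A continuum in \<open>C - U\<close> meeting \<open>B\<close> is part of
    \<open>Q0\<close>, and \<open>P\<close> misses \<open>Q0\<close> because the part of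
    \<open>Q0\<close> off \<open>V\<close> lies in \<open>P'\<close>.\<close>
  have none2: "\<forall>S. continuum S \<and> S \<subseteq> C - U \<longrightarrow> S \<inter> P = {} \<or> S \<inter> B = {}"
    using P unfolding Q0_def by blast
  obtain Q' Q where Q: "compact Q'" "compact Q" "Q' \<union> Q = C - U" "Q' \<inter> Q = {}"
    "(C - U) \<inter> P \<subseteq> Q'" "(C - U) \<inter> B \<subseteq> Q"
    using cut_wire_fence_compact[OF cU compact_imp_closed[OF P(1)] cl(2) none2] by metis
  have "U \<inter> closure V = {}" "V \<inter> closure U = {}"
    using op UV by (simp_all add: open_Int_closure_eq_empty Int_commute)
  then have AV: "A \<inter> closure V = {}" and BU: "B \<inter> closure U = {}"
    using sub by auto
  show ?thesis
  proof (rule that)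
    show "closed P" "closed Q"
      using P(1) Q(2) by (simp_all add: compact_imp_closed)
    show "P \<inter> Q = {}"
      using P Q by blast
    fix J assume J: "continuum J" "J \<subseteq> C" "J \<inter> A \<noteq> {}" "J \<inter> B \<noteq> {}"
    have U: "A \<subseteq> closure U" "B \<subseteq> closure V" "U \<subseteq> closure U" "V \<subseteq> closure V"
      using sub closure_subset by blast+
    \<comment> \<open>Off \<open>V\<close>, the only way to leave \<open>P\<close> is to jump to
      \<open>P'\<close>. Taking \<open>P' \<union> closure V\<close> as the far end therefore lets
      \<open>A\<close>, \<open>P\<close> and this end cover \<open>J\<close>; as \<open>S\<close>
      stays in \<open>P\<close>, which is disjoint from \<open>P'\<close>, it must reach
      \<open>closure V\<close>.\<close>
    obtain S where S: "continuum S" "S \<subseteq> J \<inter> P" "S \<inter> A \<noteq> {}" "S \<inter> (P' \<union> closure V) \<noteq> {}"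
    proof (rule continuum_crossing[OF J(1) cl(1) \<open>closed P\<close>, of "P' \<union> closure V"])
      show "closed (P' \<union> closure V)"
        using P compact_imp_closed by blast
      show "J \<subseteq> A \<union> P \<union> (P' \<union> closure V)"
        using P(3) J(2) U(4) by blast
      show "J \<inter> A \<inter> (P' \<union> closure V) = {}"
        using P(4,5) J(2) AV UV sub(1) by blast
      show "J \<inter> (P' \<union> closure V) \<noteq> {}"
        using J(4) U(2) by blast
    qed (use J in auto)
    obtain T where T: "continuum T" "T \<subseteq> J \<inter> Q" "T \<inter> B \<noteq> {}" "T \<inter> (Q' \<union> closure U) \<noteq> {}"
    proof (rule continuum_crossing[OF J(1) cl(2) \<open>closed Q\<close>, of "Q' \<union> closure U"])
      show "closed (Q' \<union> closure U)"
        using Q compact_imp_closed by blast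
      show "J \<subseteq> B \<union> Q \<union> (Q' \<union> closure U)"
        using Q(3) J(2) U(3) by blast
      show "J \<inter> B \<inter> (Q' \<union> closure U) = {}"
        using Q(4,6) J(2) BU UV sub(2) by blast
      show "J \<inter> (Q' \<union> closure U) \<noteq> {}"
        using J(3) U(1) by blast
    qed (use J in auto)
    have "S \<inter> closure U \<noteq> {}" "S \<inter> closure V \<noteq> {}"
      using S(2-4) P(4) U(1) by auto
    moreover have "T \<inter> closure U \<noteq> {}" "T \<inter> closure V \<noteq> {}"
      using T(2-4) Q(4) U(2) by auto
    ultimately show "(\<exists>S. continuum S \<and> S \<subseteq> J \<inter> P \<and> S \<inter> closure U \<noteq> {} \<and> S \<inter> closure V \<noteq> {}) \<and>
       (\<exists>S. continuum S \<and> S \<subseteq> J \<inter> Q \<and> S \<inter> closure U \<noteq> {} \<and> S \<inter> closure V \<noteq> {})"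
      using S(1,2) T(1,2) by (intro conjI exI[of _ S] exI[of _ T])
  qed
qed

lemma open_shrink:
  fixes A :: "'a::t4_space set"
  assumes "closed A" "open U" "A \<subseteq> U"
  obtains U' where "open U'" "A \<subseteq> U'" "closure U' \<subseteq> U"
proof -
  have "closed (- U)" "A \<inter> - U = {}"
    using assms by auto
  then obtain V W where VW: "open V" "open W" "A \<subseteq> V" "- U \<subseteq> W" "V \<inter> W = {}"
    using t4_space[OF assms(1)] by meson
  then have "closure V \<inter> W = {}"
    using open_Int_closure_eq_empty[of W V] by blast
  then show ?thesis
    using that VW by blast
qed

text \<open>A crossing of the smaller neighbourhoods \<open>U'\<close>, \<open>V'\<close> provided by one splitting is again a
  continuum joining the closed sets \<open>closure U'\<close> and \<open>closure V'\<close>, so it can be split further.\<close>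
lemma many_disjoint_crossings:
  fixes C :: "'a::metric_space set"
  assumes hi: "hereditarily_indecomposable C" and C: "compact C"
    and "closed A" "closed B" "open U" "open V" "A \<subseteq> U" "B \<subseteq> V" "U \<inter> V = {}"
  shows "\<exists>Z. (\<forall>i\<le>n::nat. closed (Z i)) \<and> (\<forall>i\<le>n. \<forall>j\<le>n. i \<noteq> j \<longrightarrow> Z i \<inter> Z j = {}) \<and>
    (\<forall>J. continuum J \<and> J \<subseteq> C \<and> J \<inter> A \<noteq> {} \<and> J \<inter> B \<noteq> {} \<longrightarrow>
       (\<forall>i\<le>n. \<exists>S. continuum S \<and> S \<subseteq> J \<inter> Z i \<and> S \<inter> closure U \<noteq> {} \<and> S \<inter> closure V \<noteq> {}))"
  using assms(3-)
proof (induction n arbitrary: A B)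
  case 0
  then have "A \<subseteq> closure U" "B \<subseteq> closure V"
    using closure_subset by blast+
  then show ?case
    by (intro exI[of _ "\<lambda>_. UNIV"]) blast
next
  case (Suc n)
  obtain U' where U': "open U'" "A \<subseteq> U'" "closure U' \<subseteq> U"
    using open_shrink[of A U] Suc.prems by blast
  obtain V' where V': "open V'" "B \<subseteq> V'" "closure V' \<subseteq> V"
    using open_shrink[of B V] Suc.prems by blast
  have UV': "U' \<inter> V' = {}"
    using U' V' Suc.prems closure_subset by blast
  obtain Y where Y: "\<forall>i\<le>n. closed (Y i)"
    "\<forall>i\<le>n. \<forall>j\<le>n. i \<noteq> j \<longrightarrow> Y i \<inter> Y j = {}"
    "\<forall>J. continuum J \<and> J \<subseteq> C \<and> J \<inter> closure U' \<noteq> {} \<and> J \<inter> closure V' \<noteq> {} \<longrightarrow>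
       (\<forall>i\<le>n. \<exists>S. continuum S \<and> S \<subseteq> J \<inter> Y i \<and> S \<inter> closure U \<noteq> {} \<and> S \<inter> closure V \<noteq> {})"
    using Suc.IH[OF closed_closure closed_closure Suc.prems(3,4) U'(3) V'(3) Suc.prems(7)]
    by (elim exE conjE) (rule that)
  obtain P Q where PQ: "closed P" "closed Q" "P \<inter> Q = {}"
    and cross: "\<And>J. \<lbrakk>continuum J; J \<subseteq> C; J \<inter> A \<noteq> {}; J \<inter> B \<noteq> {}\<rbrakk> \<Longrightarrow>
       (\<exists>S. continuum S \<and> S \<subseteq> J \<inter> P \<and> S \<inter> closure U' \<noteq> {} \<and> S \<inter> closure V' \<noteq> {}) \<and>
       (\<exists>S. continuum S \<and> S \<subseteq> J \<inter> Q \<and> S \<inter> closure U' \<noteq> {} \<and> S \<inter> closure V' \<noteq> {})"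
    using two_disjoint_crossings[OF hi C Suc.prems(1,2) U'(1) V'(1) U'(2) V'(2) UV'] by metis
  \<comment> \<open>Only the crossing in \<open>P\<close> is split further. The one in
    \<open>Q\<close> is kept whole and supplies the additional set of index
    \<open>Suc n\<close>.\<close>
  let ?Z = "\<lambda>i. if i \<le> n then P \<inter> Y i else Q"
  have sub: "closure U' \<subseteq> closure U" "closure V' \<subseteq> closure V"
    using U'(3) V'(3) closure_subset by blast+
  have "\<exists>S. continuum S \<and> S \<subseteq> J \<inter> ?Z i \<and> S \<inter> closure U \<noteq> {} \<and> S \<inter> closure V \<noteq> {}"
    if J: "continuum J" "J \<subseteq> C" "J \<inter> A \<noteq> {}" "J \<inter> B \<noteq> {}" for J i
  proof (cases "i \<le> n")
    case True
    obtain S where S: "continuum S" "S \<subseteq> J \<inter> P" "S \<inter> closure U' \<noteq> {}" "S \<inter> closure V' \<noteq> {}"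
      using cross[OF J] by blast
    then obtain T where "continuum T" "T \<subseteq> S \<inter> Y i" "T \<inter> closure U \<noteq> {}" "T \<inter> closure V \<noteq> {}"
      using Y(3)[rule_format, of S i] J True by blast
    then show ?thesis
      using S True by (intro exI[of _ T]) auto
  next
    case False
    obtain S where S: "continuum S" "S \<subseteq> J \<inter> Q" "S \<inter> closure U' \<noteq> {}" "S \<inter> closure V' \<noteq> {}"
      using cross[OF J] by blast
    then show ?thesis
      using sub False by (intro exI[of _ S]) auto
  qed
  moreover have "\<forall>i\<le>Suc n. closed (?Z i)"
    using Y PQ by auto
  moreover have "\<forall>i\<le>Suc n. \<forall>j\<le>Suc n. i \<noteq> j \<longrightarrow> ?Z i \<inter> ?Z j = {}"
  proof (intro allI impI)
    fix i j assume "i \<le> Suc n" "j \<le> Suc n" "i \<noteq> j"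
    then consider "i \<le> n" "j \<le> n" | "i \<le> n" "\<not> j \<le> n" | "\<not> i \<le> n" "j \<le> n"
      by linarith
    then show "?Z i \<inter> ?Z j = {}"
      using Y(2)[rule_format, of i j] PQ(3) \<open>i \<noteq> j\<close> by cases auto
  qed
  ultimately show ?case
    by (intro exI[of _ ?Z] conjI) blast+
qed

section \<open>Horseshoes and the full shift\<close>

lemma funpow_continuous_on:
  assumes "continuous_on C f" "f ` C \<subseteq> C"
  shows "continuous_on C (f ^^ n) \<and> (f ^^ n) ` C \<subseteq> C"
proof (induction n)
  case (Suc n)
  then have "continuous_on C (f \<circ> (f ^^ n))"
    using assms continuous_on_subset by (intro continuous_on_compose) blast+
  then show ?case
    using Suc assms by (auto simp: image_subset_iff)
qed auto

text \<open>\<open>D\<close> consists of the points whose whole orbit stays in the union of the sets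
  \<open>M i\<close>, and \<open>\<pi>\<close> reads off itineraries. Following members of
  \<open>\<K>\<close> forward under \<open>step\<close> and pulling a point back realises each
  finite itinerary; compactness of \<open>C\<close> then gives the infinite ones.\<close>

lemma horseshoe_extends_shift:
  fixes C :: "'a::metric_space set"
  assumes C: "compact C" and f: "continuous_on C f" "f ` C \<subseteq> C"
    and cl: "\<And>i. i \<in> {1..k} \<Longrightarrow> closed (M i)"
    and dis: "\<And>i j. \<lbrakk>i \<in> {1..k}; j \<in> {1..k}; i \<noteq> j\<rbrakk> \<Longrightarrow> M i \<inter> M j = {}"
    and ne: "K0 \<in> \<K>" and sub: "\<And>K. K \<in> \<K> \<Longrightarrow> K \<subseteq> C \<and> K \<noteq> {}"
    and step: "\<And>K i. K \<in> \<K> \<Longrightarrow> i \<in> {1..k} \<Longrightarrow> \<exists>K'\<in>\<K>. K' \<subseteq> f ` K \<inter> M i"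
  shows "\<exists>D \<pi>. closed D \<and> D \<subseteq> C \<inter> (\<Union>i\<in>{1..k}. M i) \<and> f ` D \<subseteq> D \<and>
            continuous_map (top_of_set D) (shift_space k) \<pi> \<and>
            \<pi> ` D = topspace (shift_space k) \<and>
            (\<forall>x\<in>D. \<pi> (f x) = shift (\<pi> x))"
proof -
  note fn = funpow_continuous_on[OF f]
  have pre: "closed (C \<inter> (f ^^ n) -` T)" if "closed T" for n T
    using fn[of n] that C by (meson compact_imp_closed continuous_on_closed_vimage continuous_closed_preimage)
  define D where "D = (\<Inter>n. C \<inter> (f ^^ n) -` (\<Union>i\<in>{1..k}. M i))"
  \<comment> \<open>On \<open>D\<close> the description is proper: some index exists by the choice
    of \<open>D\<close>, and only one because the sets \<open>M i\<close> are disjoint.\<close>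
  define \<pi> where "\<pi> = (\<lambda>x n. THE i. i \<in> {1..k} \<and> (f ^^ n) x \<in> M i)"
  have piI: "\<pi> x n = i" if "i \<in> {1..k}" "(f ^^ n) x \<in> M i" for x n i
    unfolding \<pi>_def using that dis by (intro the_equality) blast+
  have piD: "\<pi> x n \<in> {1..k} \<and> (f ^^ n) x \<in> M (\<pi> x n)" if x: "x \<in> D" for x n
  proof -
    obtain i where "i \<in> {1..k}" "(f ^^ n) x \<in> M i"
      using x unfolding D_def by blast
    then show ?thesis
      using piI by metis
  qed
  have "closed D"
    unfolding D_def using cl by (intro closed_INT ballI pre closed_UN) auto
  moreover have "D \<subseteq> C \<inter> (\<Union>i\<in>{1..k}. M i)"
  proof -
    have "D \<subseteq> C \<inter> (f ^^ 0) -` (\<Union>i\<in>{1..k}. M i)"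
      unfolding D_def by blast
    then show ?thesis by simp
  qed
  moreover have fD: "f ` D \<subseteq> D"
  proof
    fix y assume "y \<in> f ` D"
    then obtain x where x: "x \<in> D" "y = f x" by blast
    then have "y \<in> C"
      using f(2) unfolding D_def by blast
    moreover have "(f ^^ n) y \<in> (\<Union>i\<in>{1..k}. M i)" for n
      using piD[OF x(1), of "Suc n"] x(2) by (auto simp: funpow_swap1)
    ultimately show "y \<in> D"
      unfolding D_def by blast
  qed
  moreover have conj: "\<forall>x\<in>D. \<pi> (f x) = shift (\<pi> x)"
    by (auto simp: \<pi>_def shift_def funpow_swap1)
  moreover have "continuous_map (top_of_set D) (shift_space k) \<pi>"
    unfolding shift_space_def continuous_map_componentwise_UNIV
  proof
    fix n
    show "continuous_map (top_of_set D) (discrete_topology {1..k}) (\<lambda>x. \<pi> x n)"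
      unfolding continuous_map_closedin
    proof (intro conjI allI impI)
      show "(\<lambda>x. \<pi> x n) \<in> topspace (top_of_set D) \<rightarrow> topspace (discrete_topology {1..k})"
        using piD by auto
      fix T assume "closedin (discrete_topology {1..k}) T"
      then have T: "T \<subseteq> {1..k}" by simp
      then have "finite T" by (rule finite_subset) simp
      \<comment> \<open>Since \<open>T\<close> is finite, the set on the right is closed in
        \<open>D\<close>, so preimages of closed sets of symbols are closed.\<close>
      have "{x \<in> D. \<pi> x n \<in> T} = D \<inter> (C \<inter> (f ^^ n) -` (\<Union>i\<in>T. M i))"
      proof (intro set_eqI iffI)
        fix x assume "x \<in> {x \<in> D. \<pi> x n \<in> T}"
        then show "x \<in> D \<inter> (C \<inter> (f ^^ n) -` (\<Union>i\<in>T. M i))"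
          using piD[of x n] unfolding D_def by blast
      next
        fix x assume x: "x \<in> D \<inter> (C \<inter> (f ^^ n) -` (\<Union>i\<in>T. M i))"
        then obtain i where "i \<in> T" "(f ^^ n) x \<in> M i"
          by blast
        then show "x \<in> {x \<in> D. \<pi> x n \<in> T}"
          using piI[of i n x] T x by auto
      qed
      moreover have "closed (C \<inter> (f ^^ n) -` (\<Union>i\<in>T. M i))"
        using cl T \<open>finite T\<close> by (intro pre closed_UN) auto
      ultimately show "closedin (top_of_set D) {x \<in> topspace (top_of_set D). \<pi> x n \<in> T}"
        by (simp add: closedin_closed_Int)
    qed
  qed
  moreover have "\<pi> ` D = topspace (shift_space k)"
  proof
    show "\<pi> ` D \<subseteq> topspace (shift_space k)"
      using piD by (auto simp: shift_space_def)
    show "topspace (shift_space k) \<subseteq> \<pi> ` D"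
    proof
      fix s assume "s \<in> topspace (shift_space k)"
      then have s: "s n \<in> {1..k}" for n
        by (auto simp: shift_space_def)
      have fin: "\<exists>x\<in>K. \<forall>j<n. (f ^^ Suc j) x \<in> M (t j)"
        if "K \<in> \<K>" "\<forall>j. t j \<in> {1..k}" for n K t
        using that
      proof (induction n arbitrary: K t)
        case 0
        then show ?case using sub by blast
      next
        case (Suc n)
        obtain K' where K': "K' \<in> \<K>" "K' \<subseteq> f ` K \<inter> M (t 0)"
          using step Suc.prems by blast
        obtain y where y: "y \<in> K'" "\<forall>j<n. (f ^^ Suc j) y \<in> M (t (Suc j))"
          using Suc.IH[OF K'(1), of "\<lambda>j. t (Suc j)"] Suc.prems by blast
        obtain x where x: "x \<in> K" "y = f x"
          using K' y by blast
        have "(f ^^ Suc j) x \<in> M (t j)" if "j < Suc n" for j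
          using that y K' x by (cases j) (auto simp: funpow_swap1)
        then show ?case using x by blast
      qed
      define E where "E = (\<lambda>j. C \<inter> (f ^^ j) -` M (s j))"
      have "C \<inter> (\<Inter>j\<in>UNIV. E j) \<noteq> {}"
      proof (rule compact_imp_fip_image[OF C])
        show "closed (E j)" for j
          unfolding E_def using pre cl s by blast
        fix I :: "nat set" assume "finite I"
        then obtain n where n: "\<forall>j\<in>I. j < n"
          using finite_nat_set_iff_bounded by blast
        obtain x where x: "x \<in> K0" "\<forall>j<n. (f ^^ Suc j) x \<in> M (s j)"
          using fin[OF ne, of s n] s by blast
        then have "f x \<in> C"
          using sub[OF ne] f by blast
        moreover have "\<forall>j<n. (f ^^ j) (f x) \<in> M (s j)"
          using x by (simp add: funpow_swap1)
        ultimately have "f x \<in> C \<inter> (\<Inter>j\<in>I. E j)"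
          using n unfolding E_def by auto
        then show "C \<inter> (\<Inter>j\<in>I. E j) \<noteq> {}" by blast
      qed
      then obtain x where x: "x \<in> C" "\<And>j. (f ^^ j) x \<in> M (s j)"
        unfolding E_def by blast
      then have "x \<in> D"
        unfolding D_def using s by blast
      moreover have "\<pi> x = s"
        using piI s x by blast
      ultimately show "s \<in> \<pi> ` D" by blast
    qed
  qed
  ultimately show ?thesis by blast
qed

section \<open>The horseshoe of a stretching map\<close>

theorem theorem10p2:
  fixes C :: "'a::metric_space set" and U :: "nat \<Rightarrow> 'a set" and f :: "'a \<Rightarrow> 'a"
  assumes "pseudo_arc C"
    and "taut_chain_cover C 7 U"
    and "continuous_on C f" and "f ` C \<subseteq> C"
    and "stretches f U"
  shows "\<forall>k::nat. k \<ge> 2 \<longrightarrow> (\<exists>D \<pi>. closed D \<and> D \<subseteq> closure (U 4) \<and> f ` D \<subseteq> D \<and>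
            continuous_map (top_of_set D) (shift_space k) \<pi> \<and>
            \<pi> ` D = topspace (shift_space k) \<and>
            (\<forall>x\<in>D. \<pi> (f x) = shift (\<pi> x)))"
proof (intro allI impI)
  fix k :: nat
  have hi: "hereditarily_indecomposable C" and cont: "continuum C" and C: "compact C"
    using assms(1) by (auto simp: pseudo_arc_def continuum_def)
  have op: "\<And>i. i \<in> {1..7} \<Longrightarrow> openin (top_of_set C) (U i)"
    and cov: "(\<Union>i\<in>{1..7}. U i) = C"
    and meet: "\<And>i j. \<lbrakk>i \<in> {1..7}; j \<in> {1..7}\<rbrakk> \<Longrightarrow>
        (closure (U i) \<inter> closure (U j) \<noteq> {}) \<longleftrightarrow> (i \<le> j + 1 \<and> j \<le> i + 1)"
    using assms(2) by (auto simp: taut_chain_cover_def chain_cover_def)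
  have clC: "closure (U i) \<subseteq> C" if "i \<in> {1..7}" for i
    using op[OF that] C by (meson closure_minimal compact_imp_closed openin_imp_subset)
  have ivl: "{1..7} = {1,2,3,4,5,6,7::nat}"
    by auto
  have Ccov: "C = U 1 \<union> U 2 \<union> U 3 \<union> U 4 \<union> U 5 \<union> U 6 \<union> U 7"
    unfolding cov[symmetric] ivl by auto
  have far: "closure (U i) \<inter> closure (U j) = {}" if "i \<in> {1..7}" "j \<in> {1..7}" "i + 1 < j" for i j
    using meet[OF that(1,2)] that(3) by auto
  define L where "L = U 1 \<union> U 2 \<union> U 3"
  define R where "R = U 5 \<union> U 6 \<union> U 7"
  define M where "M = C - (L \<union> R)"
  have LR: "openin (top_of_set C) L" "openin (top_of_set C) R"
    unfolding L_def R_def using op by (auto intro!: openin_Un)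
  have cLR: "closed (C - L)" "closed (C - R)" "closed M"
    unfolding M_def using LR C
    by (metis closedin_closed_trans closedin_diff closedin_topspace compact_imp_closed topspace_euclidean_subtopology openin_Un)+
  have clL: "closure L = closure (U 1) \<union> closure (U 2) \<union> closure (U 3)"
    and clR: "closure R = closure (U 5) \<union> closure (U 6) \<union> closure (U 7)"
    unfolding L_def R_def by simp_all
  have LRdis: "closure L \<inter> closure R = {}"
    unfolding clL clR Int_Un_distrib Int_Un_distrib2 by (simp add: far)
  have M4: "M \<subseteq> U 4"
    unfolding M_def L_def R_def using Ccov by blast
  \<comment> \<open>Tautness enters here: \<open>M\<close> lies in \<open>U 4\<close>, whose closure
    misses the closures of \<open>U 1\<close> and \<open>U 2\<close>, so
    \<open>closure (U 3)\<close> is the only way from \<open>L\<close> into \<open>M\<close>. The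
    next fact is its mirror image.\<close>
  have M_L: "M \<inter> closure L \<subseteq> closure (U 3)"
    using M4 closure_subset[of "U 4"] far[of 1 4] far[of 2 4] unfolding clL by auto
  have M_R: "M \<inter> closure R \<subseteq> closure (U 5)"
    using M4 closure_subset[of "U 4"] far[of 4 6] far[of 4 7] unfolding clR by auto
  have in_clos: "U i \<subseteq> closure (U i)" for i
    by (rule closure_subset)
  have sep: "closure (U i) \<inter> U j = {}" "closure (U j) \<inter> U i = {}"
    if "i \<in> {1..7}" "j \<in> {1..7}" "i + 1 < j" for i j
    using far[OF that] in_clos by blast+
  have "C - L \<subseteq> U 4 \<union> U 5 \<union> U 6 \<union> U 7" "C - R \<subseteq> U 1 \<union> U 2 \<union> U 3 \<union> U 4"
    using Ccov unfolding L_def R_def by blast+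
  moreover have "closure (U 1) \<inter> (U 4 \<union> U 5 \<union> U 6 \<union> U 7) = {}"
    "closure (U 7) \<inter> (U 1 \<union> U 2 \<union> U 3 \<union> U 4) = {}"
    unfolding Int_Un_distrib by (simp_all add: sep)
  ultimately have AL: "closure (U 1) \<inter> (C - L) = {}" and BR: "closure (U 7) \<inter> (C - R) = {}"
    by blast+
  obtain U0 V0 where UV0: "open U0" "open V0" "closure (U 1) \<subseteq> U0" "closure (U 7) \<subseteq> V0" "U0 \<inter> V0 = {}"
    using t4_space[of "closure (U 1)" "closure (U 7)"] far[of 1 7] by auto
  \<comment> \<open>Keeping \<open>closure A\<close> off \<open>C - L\<close> means that a subset of
    \<open>C\<close> meeting \<open>closure A\<close> meets \<open>L\<close>; likewise for
    \<open>B\<close> and \<open>R\<close>. Crossings from \<open>closure A\<close> to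
    \<open>closure B\<close> thus still have to pass through \<open>M\<close>.\<close>
  obtain A where A: "open A" "closure (U 1) \<subseteq> A" "closure A \<subseteq> U0 \<inter> - (C - L)"
    using open_shrink[of "closure (U 1)" "U0 \<inter> - (C - L)"] UV0 AL cLR by blast
  obtain B where B: "open B" "closure (U 7) \<subseteq> B" "closure B \<subseteq> V0 \<inter> - (C - R)"
    using open_shrink[of "closure (U 7)" "V0 \<inter> - (C - R)"] UV0 BR cLR by blast
  have AB: "A \<inter> B = {}"
    using A B UV0 closure_subset by blast
  \<comment> \<open>The bound \<open>k\<close> yields sets of index 0 to \<open>k\<close>; those of
    index 1 to \<open>k\<close> serve as symbols.\<close>
  obtain Z where Z: "\<forall>i\<le>k. closed (Z i)"
    "\<forall>i\<le>k. \<forall>j\<le>k. i \<noteq> j \<longrightarrow> Z i \<inter> Z j = {}"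
    "\<forall>J. continuum J \<and> J \<subseteq> C \<and> J \<inter> closure (U 1) \<noteq> {} \<and> J \<inter> closure (U 7) \<noteq> {} \<longrightarrow>
       (\<forall>i\<le>k. \<exists>S. continuum S \<and> S \<subseteq> J \<inter> Z i \<and> S \<inter> closure A \<noteq> {} \<and> S \<inter> closure B \<noteq> {})"
    using many_disjoint_crossings[OF hi C closed_closure closed_closure A(1) B(1) A(2) B(2) AB, of k]
    by (elim exE conjE) (rule that)
  \<comment> \<open>Members need not lie in \<open>M\<close>, so \<open>C\<close> itself can start
    the horseshoe. The successors built in \<open>step\<close> do lie in \<open>M\<close>.\<close>
  define \<K> where "\<K> = {K. continuum K \<and> K \<subseteq> C \<and> K \<inter> closure (U 3) \<noteq> {} \<and> K \<inter> closure (U 5) \<noteq> {}}"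
  have step: "\<exists>K'\<in>\<K>. K' \<subseteq> f ` K \<inter> (M \<inter> Z i)" if K: "K \<in> \<K>" and i: "i \<in> {1..k}" for K i
  proof -
    have K': "continuum K" "K \<subseteq> C" "K \<inter> closure (U 3) \<noteq> {}" "K \<inter> closure (U 5) \<noteq> {}"
      using K by (auto simp: \<K>_def)
    have fcl: "f ` closure (U i) \<subseteq> closure (U j)" if "f ` U i \<subseteq> U j" "i \<in> {1..7}" for i j
      using that clC[OF that(2)] assms(3) in_clos
      by (intro image_closure_subset) (auto intro: continuous_on_subset)
    \<comment> \<open>The two orientations allowed by \<open>stretches\<close> merely exchange which
      end of \<open>K\<close> is sent to which end of the chain.\<close>
    have fK: "f ` K \<inter> closure (U 1) \<noteq> {}" "f ` K \<inter> closure (U 7) \<noteq> {}"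
      using assms(5) fcl[of 3 1] fcl[of 3 7] fcl[of 5 1] fcl[of 5 7] K'(3,4)
      unfolding stretches_def by auto blast+
    have J: "continuum (f ` K)" "f ` K \<subseteq> C"
      using K' assms(3,4) unfolding continuum_def
      by (auto intro!: compact_continuous_image connected_continuous_image intro: continuous_on_subset)
    obtain S where S: "continuum S" "S \<subseteq> f ` K \<inter> Z i" "S \<inter> closure A \<noteq> {}" "S \<inter> closure B \<noteq> {}"
      using Z(3)[rule_format, of "f ` K" i] J fK i by auto
    have SC: "S \<subseteq> C"
      using S J by blast
    \<comment> \<open>\<open>S\<close> already lies in \<open>Z i\<close>; its passage
      \<open>T\<close> from \<open>closure L\<close> to \<open>closure R\<close> within
      \<open>M\<close> lies in \<open>M \<inter> Z i\<close>, and by \<open>M_L\<close> and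
      \<open>M_R\<close> it meets \<open>closure (U 3)\<close> and
      \<open>closure (U 5)\<close>.\<close>
    obtain T where T: "continuum T" "T \<subseteq> S \<inter> M" "T \<inter> closure L \<noteq> {}" "T \<inter> closure R \<noteq> {}"
    proof (rule continuum_crossing[OF S(1) closed_closure cLR(3) closed_closure, of L R])
      show "S \<subseteq> closure L \<union> M \<union> closure R"
        using SC closure_subset unfolding M_def by blast
      show "S \<inter> closure L \<inter> closure R = {}"
        using LRdis by blast
      show "S \<inter> closure L \<noteq> {}" "S \<inter> closure R \<noteq> {}"
        using S SC A(3) B(3) closure_subset by blast+
    qed
    then have "T \<in> \<K>"
      using SC M_L M_R unfolding \<K>_def by blast
    then show ?thesis
      using T(2) S(2) by (intro bexI[of _ T]) auto
  qed
  have "C \<in> \<K>"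
    using cont clC[of 3] clC[of 5] meet[of 3 3] meet[of 5 5]
    by (simp add: \<K>_def Int_absorb1)
  have "\<exists>D \<pi>. closed D \<and> D \<subseteq> C \<inter> (\<Union>i\<in>{1..k}. M \<inter> Z i) \<and> f ` D \<subseteq> D \<and>
            continuous_map (top_of_set D) (shift_space k) \<pi> \<and>
            \<pi> ` D = topspace (shift_space k) \<and>
            (\<forall>x\<in>D. \<pi> (f x) = shift (\<pi> x))"
  proof (rule horseshoe_extends_shift[OF C assms(3,4) _ _ \<open>C \<in> \<K>\<close>])
    show "closed (M \<inter> Z i)" if "i \<in> {1..k}" for i
      using that Z(1) cLR(3) by auto
    show "M \<inter> Z i \<inter> (M \<inter> Z j) = {}" if "i \<in> {1..k}" "j \<in> {1..k}" "i \<noteq> j" for i j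
      using that Z(2)[rule_format, of i j] by auto
    show "K \<subseteq> C \<and> K \<noteq> {}" if "K \<in> \<K>" for K
      using that by (auto simp: \<K>_def)
  qed (use step in blast)
  moreover have "C \<inter> (\<Union>i\<in>{1..k}. M \<inter> Z i) \<subseteq> closure (U 4)"
    using M4 in_clos by blast
  ultimately show "\<exists>D \<pi>. closed D \<and> D \<subseteq> closure (U 4) \<and> f ` D \<subseteq> D \<and>
            continuous_map (top_of_set D) (shift_space k) \<pi> \<and>
            \<pi> ` D = topspace (shift_space k) \<and>
            (\<forall>x\<in>D. \<pi> (f x) = shift (\<pi> x))"
    by (meson subset_trans)
qed

end
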